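(* Let $(X,d_X)$ and $(Y,d_Y)$ be $g$-quasi metric spaces of the same index $r$, and let $d_{XY}$ be the product $g$-quasi metric on $X\times Y$. Then $(X\times Y,d_{XY})$ is complete if and only if both $(X,d_X)$ and $(Y,d_Y)$ are complete.
   Context: A $g$-quasi metric of index $r\ge 0$ on a nonempty set $X$ is a mapping $d:X\times X\to\mathbb R$ such that (a) for all $x,y\in X$, $d(x,y)\ge r$, and $d(x,y)=r\iff x=y$; (b) for all $x,y,z\in X$, $d(x,y)\le d(x,z)+d(z,y)$. (Symmetry is not assumed.) The pair $(X,d)$ is then a $g$-quasi metric space of index $r$. For $x\in X$ and $p>0$ let $B_d(x,p)=\{y\in X: d(x,y)<p\}$. The induced generalized topology $\mu(d)$ is the collection of all unions of members of $\{B_d(x,p):x\in X,\ p>0\}\cup\{\emptyset\}$ (it need not be closed under finite intersections). For $g$-quasi metric spaces $(X,d_X)$, $(Y,d_Y)$ of the same index $r$, the product $g$-quasi metric $d_{XY}$ on $X\times Y$ (again of index $r$) is $d_{XY}((x_1,y_1),(x_2,y_2))=\max\{d_X(x_1,x_2),d_Y(y_1,y_2)\}$. A sequence $(x_n)$ in $(X,d)$ converges to $c\in X$ if it does so in $(X,\mu(d))$, i.e. for every $V\in\mu(d)$ with $c\in V$ there is $k\in\mathbb N$ with $x_n\in V$ for all $n\ge k$. A sequence $(x_n)$ in a $g$-quasi metric space $(X,d)$ of index $r$ is Cauchy if for every $\epsilon>r$ there exists $k\in\mathbb N$ such that $d(x_m,x_n)<\epsilon$ for all $m,n\ge k$. $(X,d)$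 is complete if every Cauchy sequence in it converges to some point of $X$. *)

theory Defs
  imports Complex_Main
begin

text \<open>A space is given by a carrier set \<open>X\<close> and a total function \<open>d\<close>; only the values of
  \<open>d\<close> on \<open>X \<times> X\<close> matter.\<close>

definition g_quasi_metric_space :: "real \<Rightarrow> 'a set \<Rightarrow> ('a \<Rightarrow> 'a \<Rightarrow> real) \<Rightarrow> bool" where
  "g_quasi_metric_space r X d \<longleftrightarrow>
     r \<ge> 0 \<and> X \<noteq> {} \<and>
     (\<forall>x\<in>X. \<forall>y\<in>X. d x y \<ge> r \<and> (d x y = r \<longleftrightarrow> x = y)) \<and>
     (\<forall>x\<in>X. \<forall>y\<in>X. \<forall>z\<in>X. d x y \<le> d x z + d z y)"

definition gq_ball :: "'a set \<Rightarrow> ('a \<Rightarrow> 'a \<Rightarrow> real) \<Rightarrow> 'a \<Rightarrow> real \<Rightarrow> 'a set" where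
  "gq_ball X d x p = {y \<in> X. d x y < p}"

text \<open>For \<open>r > 0\<close> a ball need not contain a ball around each of its points, so this is not
  the family of sets containing a ball around each of their points, and it need not be closed
  under finite intersections.\<close>

definition gq_topology :: "'a set \<Rightarrow> ('a \<Rightarrow> 'a \<Rightarrow> real) \<Rightarrow> 'a set set" where
  "gq_topology X d = {\<Union>\<F> | \<F>. \<F> \<subseteq> {gq_ball X d x p | x p. x \<in> X \<and> p > 0} \<union> {{}}}"

definition gq_prod_metric ::
    "('a \<Rightarrow> 'a \<Rightarrow> real) \<Rightarrow> ('b \<Rightarrow> 'b \<Rightarrow> real) \<Rightarrow> 'a \<times> 'b \<Rightarrow> 'a \<times> 'b \<Rightarrow> real" where
  "gq_prod_metric dX dY = (\<lambda>(x1, y1) (x2, y2). max (dX x1 x2) (dY y1 y2))"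

definition gq_converges ::
    "'a set \<Rightarrow> ('a \<Rightarrow> 'a \<Rightarrow> real) \<Rightarrow> (nat \<Rightarrow> 'a) \<Rightarrow> 'a \<Rightarrow> bool" where
  "gq_converges X d s c \<longleftrightarrow>
     (\<forall>V \<in> gq_topology X d. c \<in> V \<longrightarrow> (\<exists>k. \<forall>n\<ge>k. s n \<in> V))"

definition gq_Cauchy :: "real \<Rightarrow> ('a \<Rightarrow> 'a \<Rightarrow> real) \<Rightarrow> (nat \<Rightarrow> 'a) \<Rightarrow> bool" where
  "gq_Cauchy r d s \<longleftrightarrow> (\<forall>\<epsilon>>r. \<exists>k. \<forall>m\<ge>k. \<forall>n\<ge>k. d (s m) (s n) < \<epsilon>)"

definition gq_complete :: "real \<Rightarrow> 'a set \<Rightarrow> ('a \<Rightarrow> 'a \<Rightarrow> real) \<Rightarrow> bool" where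
  "gq_complete r X d \<longleftrightarrow>
     (\<forall>s. (\<forall>n. s n \<in> X) \<and> gq_Cauchy r d s \<longrightarrow> (\<exists>c\<in>X. gq_converges X d s c))"

lemma g_quasi_metric_space_prod:
  assumes "g_quasi_metric_space r X dX" and "g_quasi_metric_space r Y dY"
  shows "g_quasi_metric_space r (X \<times> Y) (gq_prod_metric dX dY)"
proof -
  have X: "r \<ge> 0" "X \<noteq> {}" "\<And>x y. x \<in> X \<Longrightarrow> y \<in> X \<Longrightarrow> dX x y \<ge> r"
      "\<And>x y. x \<in> X \<Longrightarrow> y \<in> X \<Longrightarrow> dX x y = r \<longleftrightarrow> x = y"
      "\<And>x y z. x \<in> X \<Longrightarrow> y \<in> X \<Longrightarrow> z \<in> X \<Longrightarrow> dX x y \<le> dX x z + dX z y"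
    using assms(1) unfolding g_quasi_metric_space_def by auto
  have Y: "Y \<noteq> {}" "\<And>x y. x \<in> Y \<Longrightarrow> y \<in> Y \<Longrightarrow> dY x y \<ge> r"
      "\<And>x y. x \<in> Y \<Longrightarrow> y \<in> Y \<Longrightarrow> dY x y = r \<longleftrightarrow> x = y"
      "\<And>x y z. x \<in> Y \<Longrightarrow> y \<in> Y \<Longrightarrow> z \<in> Y \<Longrightarrow> dY x y \<le> dY x z + dY z y"
    using assms(2) unfolding g_quasi_metric_space_def by auto
  have ge: "max (dX x1 x2) (dY y1 y2) \<ge> r"
    if "x1 \<in> X" "x2 \<in> X" for x1 x2 y1 y2
    using X(3)[OF that] by linarith
  have eq: "max (dX x1 x2) (dY y1 y2) = r \<longleftrightarrow> x1 = x2 \<and> y1 = y2"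
    if "x1 \<in> X" "x2 \<in> X" "y1 \<in> Y" "y2 \<in> Y" for x1 x2 y1 y2
    using X(3,4)[OF that(1,2)] Y(2,3)[OF that(3,4)] by (auto simp: max_def split: if_splits)
  have tri: "max (dX x1 x2) (dY y1 y2) \<le> max (dX x1 x3) (dY y1 y3) + max (dX x3 x2) (dY y3 y2)"
    if "x1 \<in> X" "x2 \<in> X" "x3 \<in> X" "y1 \<in> Y" "y2 \<in> Y" "y3 \<in> Y" for x1 x2 x3 y1 y2 y3
    using X(5)[OF that(1-3)] Y(4)[OF that(4-6)] by linarith
  show ?thesis
    unfolding g_quasi_metric_space_def gq_prod_metric_def
    using X(1,2) Y(1) ge eq tri by auto
qed

end

theory Submission
  imports Defs
begin

text \<open>Balls of the maximum metric are rectangles: the ball of radius \<open>p\<close> about \<open>(x, y)\<close> is the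
  product of the balls of radius \<open>p\<close> about \<open>x\<close> and \<open>y\<close>. Hence both the Cauchy property and
  convergence can be tested in each coordinate separately. For convergence the delicate direction
  is from the product to a factor: a ball \<open>B(x, p)\<close> containing the limit \<open>a\<close> has to be completed to a
  rectangle of the same radius that contains the limit \<open>(a, b)\<close>, and for positive index small radii
  give empty balls. But \<open>r \<le> d(x, a) < p\<close>, so \<open>b\<close>, whose distance to itself is the index \<open>r\<close>, lies
  in its own ball of radius \<open>p\<close>; the ball of radius \<open>p\<close> about \<open>(x, b)\<close> is then an open set that
  contains \<open>(a, b)\<close> and projects into \<open>B(x, p)\<close>.

  Given these two coordinatewise criteria, completeness of the factors yields a limit in the
  product by pairing the coordinate limits. Conversely, a Cauchy sequence in one factor is paired
  with a constant sequence in the other (constant sequences are Cauchy because \<open>d(y, y) = r\<close>), and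
  the limit in the product is projected back.\<close>

lemma gq_ball_in_topology:
  assumes "x \<in> X" and "p > 0"
  shows "gq_ball X d x p \<in> gq_topology X d"
  unfolding gq_topology_def mem_Collect_eq
  by (rule exI[of _ "{gq_ball X d x p}"]) (use assms in auto)

text \<open>Open sets are unions of balls, so convergence has to be checked only on the balls that
  contain the limit. Their centres are arbitrary: for positive index, balls centred at the limit
  need not form a neighbourhood base.\<close>

lemma gq_converges_iff_balls:
  "gq_converges X d s c \<longleftrightarrow>
     (\<forall>x\<in>X. \<forall>p>0. c \<in> gq_ball X d x p \<longrightarrow> (\<exists>k. \<forall>n\<ge>k. s n \<in> gq_ball X d x p))"
  (is "_ \<longleftrightarrow> ?balls")
proof
  assume "gq_converges X d s c"
  then show ?balls
    unfolding gq_converges_def by (blast intro: gq_ball_in_topology)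
next
  assume balls: ?balls
  show "gq_converges X d s c"
    unfolding gq_converges_def
  proof (intro ballI impI)
    fix V
    assume "V \<in> gq_topology X d" and "c \<in> V"
    then obtain x p where "x \<in> X" "p > 0" and c: "c \<in> gq_ball X d x p"
      and sub: "gq_ball X d x p \<subseteq> V"
      unfolding gq_topology_def by blast
    with balls obtain k where "\<forall>n\<ge>k. s n \<in> gq_ball X d x p"
      by blast
    with sub show "\<exists>k. \<forall>n\<ge>k. s n \<in> V"
      by blast
  qed
qed

lemma gq_ball_prod:
  "gq_ball (X \<times> Y) (gq_prod_metric dX dY) (x, y) p = gq_ball X dX x p \<times> gq_ball Y dY y p"
  unfolding gq_ball_def gq_prod_metric_def by auto

lemma eventually_sequentially_conj:
  fixes P Q :: "nat \<Rightarrow> bool"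
  shows "(\<exists>k. \<forall>n\<ge>k. P n \<and> Q n) \<longleftrightarrow> (\<exists>k. \<forall>n\<ge>k. P n) \<and> (\<exists>k. \<forall>n\<ge>k. Q n)"
  using eventually_conj_iff[of P Q sequentially] unfolding eventually_sequentially .

lemma gq_metric_refl:
  assumes "g_quasi_metric_space r X d" and "x \<in> X"
  shows "d x x = r"
  using assms unfolding g_quasi_metric_space_def by blast

text \<open>A nonempty ball has radius exceeding the index, because no distance is below the index; so
  in every space of the same index a ball of that radius contains its centre.\<close>

lemma center_in_gq_ball_if_ball_nonempty:
  assumes "g_quasi_metric_space r X dX" and "g_quasi_metric_space r Y dY"
    and "x \<in> X" and "a \<in> gq_ball X dX x p" and "b \<in> Y"
  shows "b \<in> gq_ball Y dY b p"
proof -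
  have "r \<le> dX x a" and "dX x a < p"
    using assms(1,3,4) unfolding g_quasi_metric_space_def gq_ball_def by auto
  with gq_metric_refl[OF assms(2,5)] assms(5) show ?thesis
    unfolding gq_ball_def by simp
qed

lemma gq_converges_prod_iff:
  assumes X: "g_quasi_metric_space r X dX" and Y: "g_quasi_metric_space r Y dY"
    and a: "a \<in> X" and b: "b \<in> Y"
  shows "gq_converges (X \<times> Y) (gq_prod_metric dX dY) (\<lambda>n. (s n, t n)) (a, b) \<longleftrightarrow>
    gq_converges X dX s a \<and> gq_converges Y dY t b"
proof
  assume prod: "gq_converges (X \<times> Y) (gq_prod_metric dX dY) (\<lambda>n. (s n, t n)) (a, b)"
  have rectangle: "(\<exists>k. \<forall>n\<ge>k. s n \<in> gq_ball X dX x p) \<and> (\<exists>k. \<forall>n\<ge>k. t n \<in> gq_ball Y dY y p)"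
    if "x \<in> X" "y \<in> Y" "p > 0" "a \<in> gq_ball X dX x p" "b \<in> gq_ball Y dY y p" for x y p
    using prod[unfolded gq_converges_iff_balls, rule_format, of "(x, y)" p] that
    by (simp add: gq_ball_prod eventually_sequentially_conj)
  \<comment> \<open>Centring the rectangle at the limit in the other coordinate keeps the limit inside it.\<close>
  have "gq_converges X dX s a"
    unfolding gq_converges_iff_balls
    using rectangle[OF _ b] center_in_gq_ball_if_ball_nonempty[OF X Y _ _ b] by blast
  moreover have "gq_converges Y dY t b"
    unfolding gq_converges_iff_balls
    using rectangle[OF a] center_in_gq_ball_if_ball_nonempty[OF Y X _ _ a] by blast
  ultimately show "gq_converges X dX s a \<and> gq_converges Y dY t b" ..
next
  assume "gq_converges X dX s a \<and> gq_converges Y dY t b"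
  then show "gq_converges (X \<times> Y) (gq_prod_metric dX dY) (\<lambda>n. (s n, t n)) (a, b)"
    by (auto simp: gq_converges_iff_balls gq_ball_prod eventually_sequentially_conj)
qed

lemma gq_Cauchy_prod_iff:
  "gq_Cauchy r (gq_prod_metric dX dY) (\<lambda>n. (s n, t n)) \<longleftrightarrow>
    gq_Cauchy r dX s \<and> gq_Cauchy r dY t"
proof
  assume "gq_Cauchy r (gq_prod_metric dX dY) (\<lambda>n. (s n, t n))"
  then show "gq_Cauchy r dX s \<and> gq_Cauchy r dY t"
    unfolding gq_Cauchy_def gq_prod_metric_def by simp blast
next
  assume cauchy: "gq_Cauchy r dX s \<and> gq_Cauchy r dY t"
  show "gq_Cauchy r (gq_prod_metric dX dY) (\<lambda>n. (s n, t n))"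
    unfolding gq_Cauchy_def
  proof (intro allI impI)
    fix \<epsilon>
    assume "\<epsilon> > r"
    with cauchy obtain k l where
      "\<forall>m\<ge>k. \<forall>n\<ge>k. dX (s m) (s n) < \<epsilon>" and "\<forall>m\<ge>l. \<forall>n\<ge>l. dY (t m) (t n) < \<epsilon>"
      unfolding gq_Cauchy_def by blast
    then have "\<forall>m\<ge>max k l. \<forall>n\<ge>max k l. gq_prod_metric dX dY (s m, t m) (s n, t n) < \<epsilon>"
      unfolding gq_prod_metric_def by simp
    then show "\<exists>k. \<forall>m\<ge>k. \<forall>n\<ge>k. gq_prod_metric dX dY (s m, t m) (s n, t n) < \<epsilon>" ..
  qed
qed

lemma gq_Cauchy_const:
  assumes "g_quasi_metric_space r X d" and "x \<in> X"
  shows "gq_Cauchy r d (\<lambda>_. x)"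
  unfolding gq_Cauchy_def gq_metric_refl[OF assms] by blast

lemma gq_complete_prod_iff_pairs:
  "gq_complete r (X \<times> Y) d \<longleftrightarrow>
    (\<forall>s t. (\<forall>n. s n \<in> X) \<and> (\<forall>n. t n \<in> Y) \<and> gq_Cauchy r d (\<lambda>n. (s n, t n)) \<longrightarrow>
      (\<exists>a\<in>X. \<exists>b\<in>Y. gq_converges (X \<times> Y) d (\<lambda>n. (s n, t n)) (a, b)))"
  (is "_ \<longleftrightarrow> ?pairs")
proof
  assume complete: "gq_complete r (X \<times> Y) d"
  show ?pairs
  proof (intro allI impI)
    fix s t
    assume "(\<forall>n. s n \<in> X) \<and> (\<forall>n. t n \<in> Y) \<and> gq_Cauchy r d (\<lambda>n. (s n, t n))"
    with complete[unfolded gq_complete_def, rule_format, of "\<lambda>n. (s n, t n)"]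
    show "\<exists>a\<in>X. \<exists>b\<in>Y. gq_converges (X \<times> Y) d (\<lambda>n. (s n, t n)) (a, b)"
      by auto
  qed
next
  assume pairs: ?pairs
  show "gq_complete r (X \<times> Y) d"
    unfolding gq_complete_def
  proof (intro allI impI)
    fix u
    assume "(\<forall>n. u n \<in> X \<times> Y) \<and> gq_Cauchy r d u"
    with pairs[rule_format, of "\<lambda>n. fst (u n)" "\<lambda>n. snd (u n)"]
    show "\<exists>c\<in>X \<times> Y. gq_converges (X \<times> Y) d u c"
      by (auto simp: mem_Times_iff)
  qed
qed

theorem theorem5p9:
  fixes X :: "'a set" and Y :: "'b set"
    and dX :: "'a \<Rightarrow> 'a \<Rightarrow> real" and dY :: "'b \<Rightarrow> 'b \<Rightarrow> real"
    and r :: real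
  assumes "g_quasi_metric_space r X dX"
    and "g_quasi_metric_space r Y dY"
  shows "gq_complete r (X \<times> Y) (gq_prod_metric dX dY) \<longleftrightarrow>
    gq_complete r X dX \<and> gq_complete r Y dY"
proof -
  obtain x0 y0 where x0: "x0 \<in> X" and y0: "y0 \<in> Y"
    using assms unfolding g_quasi_metric_space_def by blast
  have coordinates: "gq_complete r (X \<times> Y) (gq_prod_metric dX dY) \<longleftrightarrow>
      (\<forall>s t. (\<forall>n. s n \<in> X) \<and> (\<forall>n. t n \<in> Y) \<and> gq_Cauchy r dX s \<and> gq_Cauchy r dY t \<longrightarrow>
        (\<exists>a\<in>X. \<exists>b\<in>Y. gq_converges X dX s a \<and> gq_converges Y dY t b))"
    unfolding gq_complete_prod_iff_pairs gq_Cauchy_prod_iff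
    by (simp add: gq_converges_prod_iff[OF assms] cong: bex_cong)
  show ?thesis
  proof
    assume "gq_complete r (X \<times> Y) (gq_prod_metric dX dY)"
    note limits = this[unfolded coordinates, rule_format]
    have "gq_complete r X dX"
      unfolding gq_complete_def
      using limits[of _ "\<lambda>_. y0"] y0 gq_Cauchy_const[OF assms(2) y0] by blast
    moreover have "gq_complete r Y dY"
      unfolding gq_complete_def
      using limits[of "\<lambda>_. x0"] x0 gq_Cauchy_const[OF assms(1) x0] by blast
    ultimately show "gq_complete r X dX \<and> gq_complete r Y dY" ..
  next
    assume "gq_complete r X dX \<and> gq_complete r Y dY"
    then show "gq_complete r (X \<times> Y) (gq_prod_metric dX dY)"
      unfolding coordinates unfolding gq_complete_def by blast
  qed
qed

end
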